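(* If $r,s\ge 2$, then $\mathrm{gp}^-(K_r\,\square\, K_s)=\min\{r,s\}$.
   Context: $K_r\,\square\,K_s$ is the Cartesian product of complete graphs: vertices are pairs $(i,j)$, and $(i,j)\sim(i',j')$ iff ($i=i'$ and $j\ne j'$) or ($j=j'$ and $i\ne i'$). A set $S$ of vertices of a connected graph $G$ is a general position set if no shortest path contains three or more vertices of $S$; it is maximal if not properly contained in another general position set; $\mathrm{gp}^-(G)$ is the number of vertices in a smallest maximal general position set. *)

theory Defs
  imports "Graph_Theory.Graph_Theory"
begin

text \<open>Undirected simple graphs are symmetric loop-free digraphs (locale \<open>graph\<close>);
  an edge is a pair of opposite arcs.\<close>

definition cartesian_product ::
    "'a pair_pre_digraph \<Rightarrow> 'b pair_pre_digraph \<Rightarrow> ('a \<times> 'b) pair_pre_digraph" (infixl \<open>\<box>\<close> 70)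
  where
    "G \<box> H = \<lparr> pverts = pverts G \<times> pverts H,
       parcs = {((i, j), (i', j')).
         (i = i' \<and> i \<in> pverts G \<and> (j, j') \<in> parcs H) \<or>
         (j = j' \<and> j \<in> pverts H \<and> (i, i') \<in> parcs G)} \<rparr>"

definition shortest_vpath :: "'a vwalk \<Rightarrow> ('a, 'b) pre_digraph \<Rightarrow> bool" where
  "shortest_vpath p G \<longleftrightarrow> vpath p G \<and>
     (\<forall>q. vpath q G \<and> hd q = hd p \<and> last q = last p \<longrightarrow> vwalk_length p \<le> vwalk_length q)"

definition general_position :: "('a, 'b) pre_digraph \<Rightarrow> 'a set \<Rightarrow> bool" where
  "general_position G S \<longleftrightarrow> S \<subseteq> verts G \<and>
     \<not> (\<exists>p. shortest_vpath p G \<and> card (S \<inter> set p) \<ge> 3)"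

definition maximal_general_position :: "('a, 'b) pre_digraph \<Rightarrow> 'a set \<Rightarrow> bool" where
  "maximal_general_position G S \<longleftrightarrow> general_position G S \<and>
     \<not> (\<exists>T. general_position G T \<and> S \<subset> T)"

text \<open>Meaningful for finite graphs: there a maximal general position set exists, and \<open>card\<close>
  is the true number of elements.\<close>

definition lower_gp_number :: "('a, 'b) pre_digraph \<Rightarrow> nat" (\<open>gp\<^sup>-\<close>) where
  "gp\<^sup>- G = (LEAST k. \<exists>S. maximal_general_position G S \<and> card S = k)"

text \<open>The product of two complete graphs has the expected adjacency, and is a connected
  simple graph.\<close>

lemma cartesian_product_complete_adj:
  assumes "K\<^bsub>r\<^esub> (with_proj G)" and "K\<^bsub>s\<^esub> (with_proj H)"
    and "i \<in> pverts G" "i' \<in> pverts G" "j \<in> pverts H" "j' \<in> pverts H"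
  shows "(i, j) \<rightarrow>\<^bsub>with_proj (G \<box> H)\<^esub> (i', j') \<longleftrightarrow>
    (i = i' \<and> j \<noteq> j') \<or> (j = j' \<and> i \<noteq> i')"
  using assms by (auto simp: complete_digraph_pair_def cartesian_product_def)

lemma cartesian_product_complete_graph:
  assumes "K\<^bsub>r\<^esub> (with_proj G)" and "K\<^bsub>s\<^esub> (with_proj H)"
  shows "pair_graph (G \<box> H)"
proof -
  have fin: "finite (pverts G)" "finite (pverts H)"
    and arcs: "parcs G = {(u, v). (u, v) \<in> pverts G \<times> pverts G \<and> u \<noteq> v}"
      "parcs H = {(u, v). (u, v) \<in> pverts H \<times> pverts H \<and> u \<noteq> v}"
    using assms by (auto simp: complete_digraph_pair_def)
  have sub: "parcs (G \<box> H) \<subseteq> pverts (G \<box> H) \<times> pverts (G \<box> H)"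
    by (auto simp: cartesian_product_def arcs)
  have finv: "finite (pverts (G \<box> H))"
    by (simp add: cartesian_product_def fin)
  show ?thesis
  proof
    show "finite (parcs (G \<box> H))"
      using sub finv by (meson finite_SigmaI finite_subset)
    show "symmetric (with_proj (G \<box> H))"
      by (auto simp: symmetric_def cartesian_product_def arcs intro!: symI)
  qed (use sub finv in \<open>auto simp: cartesian_product_def arcs\<close>)
qed

lemma cartesian_product_complete_connected:
  assumes G: "K\<^bsub>r\<^esub> (with_proj G)" and H: "K\<^bsub>s\<^esub> (with_proj H)" and "r \<ge> 1" "s \<ge> 1"
  shows "connected (with_proj (G \<box> H))"
proof -
  interpret P: pair_graph "G \<box> H"
    by (rule cartesian_product_complete_graph[OF G H])
  have V: "pverts (G \<box> H) = pverts G \<times> pverts H"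
    by (simp add: cartesian_product_def)
  have ne: "pverts G \<noteq> {}" "pverts H \<noteq> {}"
    using assms by (auto simp: complete_digraph_pair_def)
  have step: "(i, j) \<rightarrow>\<^sup>*\<^bsub>with_proj (G \<box> H)\<^esub> (i', j')"
    if "i \<in> pverts G" "i' \<in> pverts G" "j \<in> pverts H" "j' \<in> pverts H" "i = i' \<or> j = j'"
    for i i' j j'
  proof (cases "(i, j) = (i', j')")
    case True
    then show ?thesis using that V by auto
  next
    case False
    then have "(i, j) \<rightarrow>\<^bsub>with_proj (G \<box> H)\<^esub> (i', j')"
      using that by (subst cartesian_product_complete_adj[OF G H]) auto
    then show ?thesis by (auto intro: P.reachable_adjI)
  qed
  have "u \<rightarrow>\<^sup>*\<^bsub>with_proj (G \<box> H)\<^esub> v" if "u \<in> pverts (G \<box> H)" "v \<in> pverts (G \<box> H)" for u v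
  proof -
    obtain i j i' j' where uv: "u = (i, j)" "v = (i', j')" by (cases u, cases v) auto
    show ?thesis
      unfolding uv using that uv V
      by (intro P.reachable_trans[OF step[of i i j j'] step[of i i' j' j']]) auto
  qed
  then show ?thesis
    using V ne by (intro P.connectedI) (auto intro: P.reachable_mk_symmetricI)
qed

lemma complete_graph_exists:
  "K\<^bsub>n\<^esub> (with_proj \<lparr> pverts = {..<n}, parcs = {(u, v). u < n \<and> v < n \<and> u \<noteq> v} \<rparr>)"
  by (auto simp: complete_digraph_pair_def)

end

theory Submission
  imports Defs
begin

text \<open>A product of complete graphs has diameter 2, so a set of vertices is in general position
  iff it contains no corner: a cell together with another cell of its row and another cell of its
  column. If a corner-free set misses both a row and a column, the cell where they cross can be
  added, so a maximal one meets every row or every column. A full row or column of length at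
  least 2 is maximal.\<close>

definition corner_free :: "('a \<times> 'b) set \<Rightarrow> bool" where
  "corner_free S \<longleftrightarrow>
     (\<forall>a a' b b'. (a, b) \<in> S \<longrightarrow> (a, b') \<in> S \<longrightarrow> (a', b) \<in> S \<longrightarrow> a = a' \<or> b = b')"

lemma complete_digraph_pairD:
  assumes "K\<^bsub>n\<^esub> (with_proj G)"
  shows "finite (pverts G)" "card (pverts G) = n"
    "(u, v) \<in> parcs G \<longleftrightarrow> u \<in> pverts G \<and> v \<in> pverts G \<and> u \<noteq> v"
  using assms by (auto simp: complete_digraph_pair_def)

lemma exists_other:
  assumes "card A \<ge> 2"
  shows "\<exists>y\<in>A. y \<noteq> x"
proof (rule ccontr)
  assume "\<not> ?thesis"
  then have "A \<subseteq> {x}" by auto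
  then have "card A \<le> card {x}" by (intro card_mono) auto
  then show False using assms by simp
qed

text \<open>A competing path from \<open>u\<close> to \<open>w\<close> has at least two vertices
  because its ends differ, and not exactly two because \<open>u\<close> and \<open>w\<close> are not
  adjacent.\<close>

lemma shortest_vpath_triple:
  assumes "u \<rightarrow>\<^bsub>G\<^esub> v" "v \<rightarrow>\<^bsub>G\<^esub> w" "\<not> u \<rightarrow>\<^bsub>G\<^esub> w" "u \<noteq> v" "v \<noteq> w" "u \<noteq> w"
    and "{u, v, w} \<subseteq> verts G"
  shows "shortest_vpath [u, v, w] G"
  unfolding shortest_vpath_def
proof (intro conjI allI impI)
  show "vpath [u, v, w] G"
    using assms by (auto simp: vpath_def vwalk_def)
next
  fix q assume q: "vpath q G \<and> hd q = hd [u, v, w] \<and> last q = last [u, v, w]"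
  obtain x xs where xs: "q = x # xs"
    using q by (cases q) (auto simp: vpath_def vwalk_def)
  obtain y ys where ys: "xs = y # ys"
    using q xs \<open>u \<noteq> w\<close> by (cases xs) auto
  have "ys \<noteq> []"
    using q xs ys \<open>\<not> u \<rightarrow>\<^bsub>G\<^esub> w\<close> by (auto simp: vpath_def vwalk_def)
  then show "vwalk_length [u, v, w] \<le> vwalk_length q"
    unfolding xs ys by (cases ys) auto
qed

context
  fixes G :: "'a pair_pre_digraph" and H :: "'b pair_pre_digraph" and r s :: nat
  assumes G: "K\<^bsub>r\<^esub> (with_proj G)" and H: "K\<^bsub>s\<^esub> (with_proj H)"
begin

lemma verts_product: "verts (with_proj (G \<box> H)) = pverts G \<times> pverts H"
  by (simp add: cartesian_product_def)

lemma adj_product: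
  "(i, j) \<rightarrow>\<^bsub>with_proj (G \<box> H)\<^esub> (i', j') \<longleftrightarrow> i \<in> pverts G \<and> i' \<in> pverts G \<and>
     j \<in> pverts H \<and> j' \<in> pverts H \<and> ((i = i' \<and> j \<noteq> j') \<or> (j = j' \<and> i \<noteq> i'))"
  by (auto simp: cartesian_product_def complete_digraph_pairD[OF G] complete_digraph_pairD[OF H])

text \<open>Change one coordinate at a time, passing through \<open>(i, j')\<close> if both differ:
  this is the diameter bound. The conditional bound for adjacent ends later shows that a shortest
  path on three vertices has nonadjacent ends.\<close>

lemma short_vpath_product:
  assumes "u \<in> pverts G \<times> pverts H" "v \<in> pverts G \<times> pverts H"
  obtains q where "vpath q (with_proj (G \<box> H))" "hd q = u" "last q = v" "length q \<le> 3"
    "u \<rightarrow>\<^bsub>with_proj (G \<box> H)\<^esub> v \<Longrightarrow> length q \<le> 2"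
proof -
  obtain i j i' j' where uv: "u = (i, j)" "v = (i', j')" by (cases u, cases v)
  show ?thesis
  proof (cases "i = i' \<or> j = j'")
    case True
    show ?thesis
    proof (cases "u = v")
      case True
      then show ?thesis
        using assms
        by (intro that[of "[u]"]) (auto simp: vpath_def vwalk_def verts_product simp del: with_proj_simps)
    next
      case False
      with True assms uv show ?thesis
        by (intro that[of "[u, v]"])
          (auto simp: vpath_def vwalk_def verts_product adj_product simp del: with_proj_simps)
    qed
  next
    case False
    with assms uv show ?thesis
      by (intro that[of "[u, (i, j'), v]"])
        (auto simp: vpath_def vwalk_def verts_product adj_product simp del: with_proj_simps)
  qed
qed

lemma general_position_product_iff:
  "general_position (with_proj (G \<box> H)) S \<longleftrightarrow> S \<subseteq> pverts G \<times> pverts H \<and> corner_free S"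
  (is "?gp \<longleftrightarrow> ?rhs")
proof
  assume gp: ?gp
  then have sub: "S \<subseteq> pverts G \<times> pverts H"
    by (simp add: general_position_def verts_product del: with_proj_simps)
  have "a = a' \<or> b = b'" if *: "(a, b) \<in> S" "(a, b') \<in> S" "(a', b) \<in> S" for a a' b b'
  proof (rule ccontr)
    assume "\<not> ?thesis"
    then have ne: "a \<noteq> a'" "b \<noteq> b'" by auto
    \<comment> \<open>The path turns at the corner \<open>(a, b)\<close>. Its ends differ in both
      coordinates, so they are not adjacent and the path is shortest.\<close>
    let ?p = "[(a, b'), (a, b), (a', b)]"
    have "shortest_vpath ?p (with_proj (G \<box> H))"
      using * sub ne
      by (intro shortest_vpath_triple) (auto simp: adj_product verts_product simp del: with_proj_simps)
    moreover have "S \<inter> set ?p = set ?p" using * by auto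
    then have "card (S \<inter> set ?p) = 3" using ne by simp
    ultimately show False
      using gp unfolding general_position_def by (metis order_refl)
  qed
  then show ?rhs using sub unfolding corner_free_def by blast
next
  assume rhs: ?rhs
  have False if p: "shortest_vpath p (with_proj (G \<box> H))" and card: "card (S \<inter> set p) \<ge> 3" for p
  proof -
    have vp: "vpath p (with_proj (G \<box> H))" using p by (simp add: shortest_vpath_def)
    then have pne: "p \<noteq> []" and dist: "distinct p" and pset: "set p \<subseteq> pverts G \<times> pverts H"
      by (auto simp: vpath_def vwalk_def verts_product simp del: with_proj_simps)
    obtain q where q: "vpath q (with_proj (G \<box> H))" "hd q = hd p" "last q = last p" "length q \<le> 3"
      "hd p \<rightarrow>\<^bsub>with_proj (G \<box> H)\<^esub> last p \<Longrightarrow> length q \<le> 2"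
      using pset pne by (elim short_vpath_product[of "hd p" "last p", rotated 2]) auto
    \<comment> \<open>\<open>vwalk_length\<close> counts arcs and is 0 both for the empty list and
      for a single vertex, so passing to \<open>length\<close> uses that both lists are
      nonempty.\<close>
    have le: "length p \<le> length q"
    proof -
      have "vwalk_length p \<le> vwalk_length q"
        using p q unfolding shortest_vpath_def by blast
      moreover have "q \<noteq> []" using q(1) by (auto simp: vpath_def vwalk_def)
      ultimately show ?thesis using pne by (cases p; cases q) auto
    qed
    \<comment> \<open>Three vertices of \<open>S\<close> on a path of at most three vertices:
      \<open>p\<close> has exactly three, and all of them lie in \<open>S\<close>.\<close>
    have "card (S \<inter> set p) \<le> card (set p)" by (intro card_mono) auto
    then have len: "length p = 3" and cardp: "card (set p) = card (S \<inter> set p)"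
      using card le q(4) distinct_card[OF dist] by auto
    have "S \<inter> set p = set p" using cardp by (intro card_subset_eq) auto
    moreover obtain x y z where xyz: "p = [x, y, z]"
      using len by (auto simp: numeral_3_eq_3 length_Suc_conv)
    ultimately have inS: "x \<in> S" "y \<in> S" "z \<in> S" by auto
    \<comment> \<open>Adjacent ends would give a comparison path with only two vertices.\<close>
    have nadj: "\<not> x \<rightarrow>\<^bsub>with_proj (G \<box> H)\<^esub> z" using q(5) le len xyz by auto
    have adj: "x \<rightarrow>\<^bsub>with_proj (G \<box> H)\<^esub> y" "y \<rightarrow>\<^bsub>with_proj (G \<box> H)\<^esub> z"
      using vp xyz by (auto simp: vpath_def vwalk_def simp del: with_proj_simps)
    obtain a b c d e f where co: "x = (a, b)" "y = (c, d)" "z = (e, f)"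
      by (cases x, cases y, cases z)
    have "x \<noteq> z" using dist xyz by simp
    \<comment> \<open>If both steps changed the same coordinate, the ends would be equal or
      adjacent. So one step changes each coordinate, and \<open>y\<close> is a corner.\<close>
    with nadj adj have "(a = c \<and> b \<noteq> d \<and> d = f \<and> c \<noteq> e) \<or> (b = d \<and> a \<noteq> c \<and> c = e \<and> d \<noteq> f)"
      unfolding co adj_product by auto
    then show False
      using rhs inS unfolding co corner_free_def by blast
  qed
  then show ?gp
    using rhs by (auto simp: general_position_def verts_product simp del: with_proj_simps)
qed

lemma maximal_general_position_card_ge:
  assumes "maximal_general_position (with_proj (G \<box> H)) S"
  shows "min r s \<le> card S"
proof -
  have gp: "S \<subseteq> pverts G \<times> pverts H" "corner_free S"
    and mx: "\<And>T. T \<subseteq> pverts G \<times> pverts H \<Longrightarrow> corner_free T \<Longrightarrow> \<not> S \<subset> T"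
    using assms by (auto simp: maximal_general_position_def general_position_product_iff)
  have fin: "finite S"
    using gp(1) complete_digraph_pairD(1)[OF G] complete_digraph_pairD(1)[OF H]
    by (meson finite_SigmaI finite_subset)
  have "pverts G \<subseteq> fst ` S \<or> pverts H \<subseteq> snd ` S"
  proof (rule ccontr)
    assume "\<not> ?thesis"
    then obtain a b where ab: "a \<in> pverts G" "b \<in> pverts H" "a \<notin> fst ` S" "b \<notin> snd ` S" by auto
    then have out: "(a, y) \<notin> S" "(x, b) \<notin> S" for x y by force+
    \<comment> \<open>Each cell of a corner shares its row or column with another cell of it,
      whereas \<open>(a, b)\<close> is alone in both.\<close>
    have "corner_free (insert (a, b) S)"
      using gp(2) out unfolding corner_free_def by blast
    moreover have "insert (a, b) S \<subseteq> pverts G \<times> pverts H" using gp(1) ab by auto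
    moreover have "S \<subset> insert (a, b) S" using out by blast
    ultimately show False using mx by blast
  qed
  \<comment> \<open>A projection of \<open>S\<close> that covers a factor has at least as many
    elements as that factor, and at most \<open>card S\<close>.\<close>
  then show ?thesis
  proof
    assume "pverts G \<subseteq> fst ` S"
    then have "r \<le> card S"
      using surj_card_le[OF fin] complete_digraph_pairD(2)[OF G] by auto
    then show ?thesis by simp
  next
    assume "pverts H \<subseteq> snd ` S"
    then have "s \<le> card S"
      using surj_card_le[OF fin] complete_digraph_pairD(2)[OF H] by auto
    then show ?thesis by simp
  qed
qed

text \<open>With any further cell \<open>(a, c)\<close>, the column has a corner at
  \<open>(a, b)\<close>, whose third cell \<open>(a', b)\<close> exists since the column has at
  least two cells.\<close>

lemma maximal_general_position_column:
  assumes "r \<ge> 2" "b \<in> pverts H"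
  shows "maximal_general_position (with_proj (G \<box> H)) (pverts G \<times> {b})"
proof -
  have other: "\<exists>a' \<in> pverts G. a' \<noteq> a" for a
    using exists_other[of "pverts G" a] assms(1) complete_digraph_pairD(2)[OF G] by simp
  have "\<not> corner_free T"
    if T: "T \<subseteq> pverts G \<times> pverts H" "pverts G \<times> {b} \<subset> T" for T
  proof -
    obtain a c where ac: "(a, c) \<in> T" "(a, c) \<notin> pverts G \<times> {b}" using T(2) by auto
    then have "a \<in> pverts G" "c \<noteq> b" using T(1) by auto
    moreover obtain a' where "a' \<in> pverts G" "a' \<noteq> a" using other by blast
    ultimately have "(a, b) \<in> T" "(a', b) \<in> T" using T(2) by auto
    then show ?thesis
      using ac \<open>c \<noteq> b\<close> \<open>a' \<noteq> a\<close> unfolding corner_free_def by metis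
  qed
  then show ?thesis
    using assms(2)
    by (auto simp: maximal_general_position_def general_position_product_iff corner_free_def)
qed

text \<open>The same argument with the factors exchanged: a further cell \<open>(c, b)\<close> makes
  \<open>(a, b)\<close> a corner together with \<open>(a, b')\<close>.\<close>

lemma maximal_general_position_row:
  assumes "s \<ge> 2" "a \<in> pverts G"
  shows "maximal_general_position (with_proj (G \<box> H)) ({a} \<times> pverts H)"
proof -
  have other: "\<exists>b' \<in> pverts H. b' \<noteq> b" for b
    using exists_other[of "pverts H" b] assms(1) complete_digraph_pairD(2)[OF H] by simp
  have "\<not> corner_free T"
    if T: "T \<subseteq> pverts G \<times> pverts H" "{a} \<times> pverts H \<subset> T" for T
  proof -
    obtain c b where cb: "(c, b) \<in> T" "(c, b) \<notin> {a} \<times> pverts H" using T(2) by auto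
    then have "b \<in> pverts H" "c \<noteq> a" using T(1) by auto
    moreover obtain b' where "b' \<in> pverts H" "b' \<noteq> b" using other by blast
    ultimately have "(a, b) \<in> T" "(a, b') \<in> T" using T(2) by auto
    then show ?thesis
      using cb \<open>c \<noteq> a\<close> \<open>b' \<noteq> b\<close> unfolding corner_free_def by metis
  qed
  then show ?thesis
    using assms(2)
    by (auto simp: maximal_general_position_def general_position_product_iff corner_free_def)
qed

end

theorem theorem5p3:
  fixes G :: "'a pair_pre_digraph" and H :: "'b pair_pre_digraph" and r s :: nat
  assumes "K\<^bsub>r\<^esub> (with_proj G)" and "K\<^bsub>s\<^esub> (with_proj H)"
    and "r \<ge> 2" and "s \<ge> 2"
  shows "gp\<^sup>- (with_proj (G \<box> H)) = min r s"
  unfolding lower_gp_number_def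
proof (rule Least_equality)
  note card = complete_digraph_pairD(2)[OF assms(1)] complete_digraph_pairD(2)[OF assms(2)]
  obtain a b where ab: "a \<in> pverts G" "b \<in> pverts H"
    using exists_other card assms(3,4) by metis
  show "\<exists>S. maximal_general_position (with_proj (G \<box> H)) S \<and> card S = min r s"
  \<comment> \<open>A column has \<open>r\<close> cells and a row has \<open>s\<close>; the witness
    is the shorter of the two.\<close>
  proof (cases "r \<le> s")
    case True
    then show ?thesis
      using maximal_general_position_column[OF assms(1,2,3) ab(2)] card
      by (intro exI[of _ "pverts G \<times> {b}"]) (simp add: card_cartesian_product)
  next
    case False
    then show ?thesis
      using maximal_general_position_row[OF assms(1,2,4) ab(1)] card
      by (intro exI[of _ "{a} \<times> pverts H"]) (simp add: card_cartesian_product)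
  qed
next
  fix k assume "\<exists>S. maximal_general_position (with_proj (G \<box> H)) S \<and> card S = k"
  then show "min r s \<le> k"
    using maximal_general_position_card_ge[OF assms(1,2)] by blast
qed

end
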